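(* Let $0<\gamma<1$ be a quadratic irrational such that $1/\gamma$ has purely periodic continued fraction $$[a_1,a_2,\ldots,a_P,a_1,a_2,\ldots,a_P,a_1,a_2,\ldots,a_P,\ldots],$$ and let $\alpha\in\mathbb{Q}(\gamma)$ with $\alpha\ge 0$. Then the sums-complement set $S_\alpha$ is $\gamma$-Ostrowski automatic.
   Context: For a real number $\alpha$, the sums-complement set is $$S_\alpha=\{n\ge 1 : \text{there do not exist integers } i,j\ge 1 \text{ with } n=\lfloor i\alpha\rfloor-\lfloor j\alpha\rfloor\},$$ i.e., the positive integers that are not the difference of two elements of the Beatty sequence $(\lfloor n\alpha\rfloor)_{n\ge 1}$. Let $0<\gamma<1$ be irrational with continued fraction $[a_0,a_1,a_2,\ldots]$, $a_0=0$. Define $p_i=a_ip_{i-1}+p_{i-2}$, $q_i=a_iq_{i-1}+q_{i-2}$ for $i\ge 0$, with $p_{-2}=q_{-1}=0$ and $q_{-2}=p_{-1}=1$. Every natural number $n$ can be written uniquely (up to leading zeros) as $n=\sum_{0\le i\le t}e_iq_i$ with integers $e_i$ satisfying: (a) $0\le e_i\le a_{i+1}$ for $i\ge 1$; (b) for $i\ge 1$, $e_i=a_{i+1}$ implies $e_{i-1}=0$; (c) $0\le e_0<a_1$. The word $(n)_\gamma=e_te_{t-1}\cdots e_0$ (most significant digit first) is the Ostrowski $\gamma$-representation of $n$. A set $S$ of natural numbers is $\gamma$-Ostrowski automatic if there is a finite automaton that takes the Ostrowski $\gamma$-representation of $n$ as input and accepts if and only if $n\in S$. *)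

theory Defs
  imports Complex_Main "HOL-Algebra.Algebraic_Closure_Type" "HOL-Algebra.Generated_Fields"
begin

definition sums_complement :: "real \<Rightarrow> nat set" where
  "sums_complement \<alpha> =
     {n. n \<ge> 1 \<and> \<not> (\<exists>i j :: nat. i \<ge> 1 \<and> j \<ge> 1 \<and>
                          int n = \<lfloor>real i * \<alpha>\<rfloor> - \<lfloor>real j * \<alpha>\<rfloor>)}"

(* The complete quotients and partial quotients of the regular continued fraction of x.
   They carry the intended meaning for irrational x, where no complete quotient is an integer. *)
fun complete_quotient :: "real \<Rightarrow> nat \<Rightarrow> real" where
  "complete_quotient x 0 = x"
| "complete_quotient x (Suc i) = 1 / frac (complete_quotient x i)"

definition partial_quotient :: "real \<Rightarrow> nat \<Rightarrow> int" where
  "partial_quotient x i = \<lfloor>complete_quotient x i\<rfloor>"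

(* Denominators of the convergents, q_i = a_i q_{i-1} + q_{i-2}. With q_{-2} = 1 and q_{-1} = 0
   the recurrence gives q_0 = 1 and q_1 = a_1. *)
fun cf_denom :: "real \<Rightarrow> nat \<Rightarrow> int" where
  "cf_denom x 0 = 1"
| "cf_denom x (Suc 0) = partial_quotient x 1"
| "cf_denom x (Suc (Suc i)) =
     partial_quotient x (Suc (Suc i)) * cf_denom x (Suc i) + cf_denom x i"

(* Words are written with the most significant digit first, so digit e_i is rev w ! i.
   Leading zeros are allowed; the empty word represents 0. *)
definition ostrowski_rep :: "real \<Rightarrow> nat list \<Rightarrow> nat \<Rightarrow> bool" where
  "ostrowski_rep \<gamma> w n \<longleftrightarrow>
     (let e = (\<lambda>i. int (rev w ! i)) in
       (\<forall>i. 1 \<le> i \<and> i < length w \<longrightarrow> e i \<le> partial_quotient \<gamma> (i + 1)) \<and>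
       (\<forall>i. 1 \<le> i \<and> i < length w \<and> e i = partial_quotient \<gamma> (i + 1) \<longrightarrow> e (i - 1) = 0) \<and>
       (0 < length w \<longrightarrow> e 0 < partial_quotient \<gamma> 1) \<and>
       int n = (\<Sum>i<length w. e i * cf_denom \<gamma> i))"

record ('s, 'a) dfa =
  dfa_states :: "'s set"
  dfa_alphabet :: "'a set"
  dfa_init :: 's
  dfa_final :: "'s set"
  dfa_trans :: "'s \<Rightarrow> 'a \<Rightarrow> 's"

definition wf_dfa :: "('s, 'a) dfa \<Rightarrow> bool" where
  "wf_dfa M \<longleftrightarrow>
     finite (dfa_states M) \<and> finite (dfa_alphabet M) \<and> dfa_init M \<in> dfa_states M \<and> dfa_final M \<subseteq> dfa_states M \<and>
     (\<forall>s\<in>dfa_states M. \<forall>a\<in>dfa_alphabet M. dfa_trans M s a \<in> dfa_states M)"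

definition dfa_accepts :: "('s, 'a) dfa \<Rightarrow> 'a list \<Rightarrow> bool" where
  "dfa_accepts M w \<longleftrightarrow> w \<in> lists (dfa_alphabet M) \<and> foldl (dfa_trans M) (dfa_init M) w \<in> dfa_final M"

(* Natural numbers as states are no restriction, the state set being finite.
   The automaton has to be correct on every representation of n, however many leading zeros
   it has; nothing is required of it on words that represent no number. *)
definition ostrowski_automatic :: "real \<Rightarrow> nat set \<Rightarrow> bool" where
  "ostrowski_automatic \<gamma> S \<longleftrightarrow>
     (\<exists>M :: (nat, nat) dfa. wf_dfa M \<and>
        (\<forall>n w. ostrowski_rep \<gamma> w n \<longrightarrow>
           w \<in> lists (dfa_alphabet M) \<and> (dfa_accepts M w \<longleftrightarrow> n \<in> S)))"

definition quadratic_irrational :: "real \<Rightarrow> bool" where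
  "quadratic_irrational x \<longleftrightarrow>
     x \<notin> \<rat> \<and>
     (\<exists>a b c :: int. a \<noteq> 0 \<and> real_of_int a * x\<^sup>2 + real_of_int b * x + real_of_int c = 0)"

(* The subfield of the reals generated by x; ring_of_type_algebra is the real field as a record. *)
definition rat_adjoin :: "real \<Rightarrow> real set" where
  "rat_adjoin x = generate_field (ring_of_type_algebra :: real ring) {x}"

end

theory Submission
  imports Defs "HOL-Analysis.Kronecker_Approximation_Theorem"
begin

text \<open>By density of the fractional parts of \<open>j * \<alpha>\<close> (if \<open>\<alpha>\<close> is rational: by
  periodicity), \<open>n\<close> lies in the sums complement of \<open>\<alpha> > 0\<close> iff \<open>n * \<beta>\<close> has distance at
  least \<open>\<beta>\<close> from every integer, where \<open>\<beta> = 1 / \<alpha> = (r + s * \<gamma>) / t\<close>. With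
  \<open>N = \<Sum> e\<^sub>i q\<^sub>i\<close>, \<open>M = \<Sum> e\<^sub>i p\<^sub>i\<close> and \<open>D = N * \<gamma> - M\<close>, which is bounded, this
  condition is a finite Boolean combination of conditions on \<open>r * N + s * M\<close> modulo \<open>t\<close> and of
  comparisons of \<open>s * D\<close> with elements of \<open>\<int> + \<int>\<gamma>\<close>. Each of these has only finitely many
  residuals with respect to the trailing digits: the former because the recurrence is periodic, the
  latter because the remaining threshold, measured in units of the current approximation error, is
  an integer combination \<open>m - m' / g\<close> in which both \<open>m\<close> and \<open>m'\<close> stay bounded.\<close>

section \<open>Languages of finite index\<close>

text \<open>A Myhill-Nerode condition read from the least significant end: trailing words
  \<open>v\<close> are classified by their effect on all leading words \<open>w\<close>, since the
  weights in \<open>v\<close> do not depend on \<open>w\<close>. The type of values is open so that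
  residues can be handled before they are compared.\<close>

definition finite_index :: "'a set \<Rightarrow> ('a list \<Rightarrow> 'b) \<Rightarrow> bool" where
  "finite_index A F \<longleftrightarrow> finite ((\<lambda>v. \<lambda>w\<in>lists A. F (w @ v)) ` lists A)"

lemma finite_image_factor:
  assumes "finite (g ` S)" and "\<And>x y. x \<in> S \<Longrightarrow> y \<in> S \<Longrightarrow> g x = g y \<Longrightarrow> h x = h y"
  shows "finite (h ` S)"
proof -
  have "h x = h (inv_into S g (g x))" if "x \<in> S" for x
    using that by (intro assms(2)) (auto simp: inv_into_into f_inv_into_f)
  then have "h ` S \<subseteq> (\<lambda>z. h (inv_into S g z)) ` (g ` S)"
    by auto
  with assms(1) show ?thesis
    by (meson finite_imageI finite_subset)
qed

lemma finite_indexI: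
  assumes "finite (\<sigma> ` lists A)"
    and "\<And>v v' w. v \<in> lists A \<Longrightarrow> v' \<in> lists A \<Longrightarrow> w \<in> lists A \<Longrightarrow> \<sigma> v = \<sigma> v' \<Longrightarrow> F (w @ v) = F (w @ v')"
  shows "finite_index A F"
  unfolding finite_index_def
  by (rule finite_image_factor[OF assms(1)]) (auto intro!: restrict_ext assms(2))

lemma finite_index_const: "finite_index A (\<lambda>w. c)"
  by (rule finite_indexI[where \<sigma> = "\<lambda>_. ()"]) auto

lemma finite_index_compose2:
  assumes "finite_index A F" "finite_index A G"
  shows "finite_index A (\<lambda>w. H (F w) (G w))"
proof (rule finite_indexI)
  let ?\<sigma> = "\<lambda>v. (\<lambda>w\<in>lists A. F (w @ v), \<lambda>w\<in>lists A. G (w @ v))"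
  show "finite (?\<sigma> ` lists A)"
    by (rule finite_subset[OF _ finite_cartesian_product[OF assms[unfolded finite_index_def]]]) auto
  show "H (F (w @ v)) (G (w @ v)) = H (F (w @ v')) (G (w @ v'))"
    if "w \<in> lists A" "?\<sigma> v = ?\<sigma> v'" for v v' w
  proof -
    have "F (w @ v) = F (w @ v')" "G (w @ v) = G (w @ v')"
      using that by (metis (no_types, lifting) prod.inject restrict_apply')+
    then show ?thesis by simp
  qed
qed

lemma finite_index_Bex:
  assumes "finite I" "\<And>i. i \<in> I \<Longrightarrow> finite_index A (F i)"
  shows "finite_index A (\<lambda>w. \<exists>i\<in>I. F i w)"
  using assms
proof (induction I rule: finite_induct)
  case empty
  then show ?case by (simp add: finite_index_const)
next
  case (insert j I)
  then have "finite_index A (\<lambda>w. F j w \<or> (\<exists>i\<in>I. F i w))"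
    by (intro finite_index_compose2[where H = "(\<or>)"]) auto
  then show ?case by simp
qed

text \<open>Reversal: finitely many distinct columns of the table \<open>F (w @ v)\<close> leave only finitely many
  distinct rows, and the rows are the states of an automaton reading \<open>w\<close> from the left.\<close>

lemma finite_index_dfa:
  fixes F :: "nat list \<Rightarrow> bool"
  assumes "finite A" "finite_index A F"
  obtains M :: "(nat, nat) dfa" where "wf_dfa M" "dfa_alphabet M = A"
    "\<And>w. w \<in> lists A \<Longrightarrow> dfa_accepts M w \<longleftrightarrow> F w"
proof -
  define col where "col v = (\<lambda>w\<in>lists A. F (w @ v))" for v
  define row where "row w = (\<lambda>v\<in>lists A. F (w @ v))" for w
  have fin_col: "finite (col ` lists A)"
    using assms(2) by (simp add: finite_index_def col_def[abs_def])
  have "finite (row ` lists A)"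
  proof (rule finite_image_factor)
    \<comment> \<open>A row is determined by its entries in the finitely many distinct columns, so
      it amounts to a truth-valued map on a finite set.\<close>
    let ?g = "\<lambda>w. \<lambda>c\<in>col ` lists A. c w"
    have "?g ` lists A \<subseteq> (col ` lists A) \<rightarrow>\<^sub>E UNIV" by auto
    moreover have "finite ((col ` lists A) \<rightarrow>\<^sub>E (UNIV :: bool set))"
      using fin_col by (intro finite_PiE) auto
    ultimately show "finite (?g ` lists A)" by (rule finite_subset)
    fix w w' assume w: "w \<in> lists A" "w' \<in> lists A" and eq: "?g w = ?g w'"
    have "F (w @ v) = F (w' @ v)" if "v \<in> lists A" for v
    proof -
      have "col v w = col v w'"
        using fun_cong[OF eq, of "col v"] that by simp
      then show ?thesis using w by (simp add: col_def)
    qed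
    then show "row w = row w'" by (auto simp: row_def intro!: restrict_ext)
  qed
  then obtain enc :: "_ \<Rightarrow> nat" where enc: "inj_on enc (row ` lists A)"
    using finite_imp_inj_to_nat_seg by metis
  define c where "c w = enc (row w)" for w
  have c_eq: "F (w @ v) = F (w' @ v)"
    if "w \<in> lists A" "w' \<in> lists A" "v \<in> lists A" "c w = c w'" for w w' v
  proof -
    have "row w = row w'"
      using that enc by (auto simp: c_def dest: inj_onD)
    then show ?thesis using that(3) by (metis row_def restrict_apply')
  qed
  have c_snoc: "c (w @ [d]) = c (w' @ [d])"
    if "w \<in> lists A" "w' \<in> lists A" "d \<in> A" "c w = c w'" for w w' d
  proof -
    have "row (w @ [d]) = row (w' @ [d])"
      unfolding row_def using that c_eq[OF that(1,2) _ that(4), of "d # v" for v] by (intro restrict_ext) auto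
    then show ?thesis by (simp add: c_def)
  qed
  \<comment> \<open>A transition sees only the code of a row, so it appends the digit to some word
    with that code; \<open>c_snoc\<close> makes the choice of this word irrelevant.\<close>
  define rep where "rep s = (SOME w. w \<in> lists A \<and> c w = s)" for s
  have rep: "rep (c w) \<in> lists A \<and> c (rep (c w)) = c w" if "w \<in> lists A" for w
    unfolding rep_def by (rule someI[where x = w]) (use that in auto)
  define M :: "(nat, nat) dfa" where
    "M = \<lparr>dfa_states = c ` lists A, dfa_alphabet = A, dfa_init = c [],
          dfa_final = c ` {w \<in> lists A. F w}, dfa_trans = (\<lambda>s d. c (rep s @ [d]))\<rparr>"
  have wf: "wf_dfa M"
  proof -
    have "finite (c ` lists A)"
      using finite_imageI[OF \<open>finite (row ` lists A)\<close>, of enc]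
      by (simp add: c_def[abs_def] image_image)
    moreover have "c (rep s @ [d]) \<in> c ` lists A" if "s \<in> c ` lists A" "d \<in> A" for s d
      proof -
      obtain w where "w \<in> lists A" "s = c w" using \<open>s \<in> c ` lists A\<close> by blast
      then have "rep s @ [d] \<in> lists A" using rep[of w] \<open>d \<in> A\<close> by auto
      then show ?thesis by (rule imageI)
    qed
    ultimately show ?thesis using assms(1) by (auto simp: wf_dfa_def M_def)
  qed
  have run: "foldl (dfa_trans M) (dfa_init M) w = c w" if "w \<in> lists A" for w
    using that
  proof (induction w rule: rev_induct)
    case Nil
    then show ?case by (simp add: M_def)
  next
    case (snoc d w)
    then have w: "w \<in> lists A" "d \<in> A" by auto
    with snoc have "foldl (dfa_trans M) (dfa_init M) (w @ [d]) = c (rep (c w) @ [d])"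
      by (simp add: M_def)
    also have "\<dots> = c (w @ [d])"
      using w rep[of w] by (intro c_snoc) auto
    finally show ?case .
  qed
  have "dfa_accepts M w \<longleftrightarrow> F w" if w: "w \<in> lists A" for w
  proof -
    have "dfa_accepts M w \<longleftrightarrow> c w \<in> c ` {w \<in> lists A. F w}"
      using w run[OF w] by (simp add: dfa_accepts_def M_def)
    also have "\<dots> \<longleftrightarrow> F w"
    proof
      assume "c w \<in> c ` {w \<in> lists A. F w}"
      then obtain w' where "w' \<in> lists A" "F w'" "c w = c w'" by blast
      with c_eq[OF w, of w' "[]"] show "F w" by simp
    qed (use w in blast)
    finally show ?thesis .
  qed
  moreover have "dfa_alphabet M = A" by (simp add: M_def)
  ultimately show ?thesis using that wf by blast
qed

section \<open>Linear recurrences and digit sums\<close>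

text \<open>One recurrence for all sequences involved: \<open>lin_rec b 0 1\<close> lists q_(-1),
  q_0, q_1, ..., \<open>lin_rec b (- 1) 0\<close> the negated numerators -p_(-1), -p_0, ..., both
  over the integers, and \<open>lin_rec b (- 1) (g 0)\<close> the real differences q_i * \<gamma> -
  p_i. Here \<open>b i\<close> is the partial quotient a_(i+1) of \<gamma>.\<close>

fun lin_rec :: "(nat \<Rightarrow> int) \<Rightarrow> 'a::comm_ring_1 \<Rightarrow> 'a \<Rightarrow> nat \<Rightarrow> 'a" where
  "lin_rec b x y 0 = x"
| "lin_rec b x y (Suc 0) = y"
| "lin_rec b x y (Suc (Suc i)) = of_int (b i) * lin_rec b x y (Suc i) + lin_rec b x y i"

lemma lin_rec_shift:
  "lin_rec b x y (i + l) = lin_rec (\<lambda>i. b (i + l)) (lin_rec b x y l) (lin_rec b x y (Suc l)) i"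
  by (induction i rule: induct_nat_012) auto

lemma lin_rec_linear:
  "lin_rec b (x * u + y * v) (x * u' + y * v') i = x * lin_rec b u u' i + y * lin_rec b v v' i"
  by (induction i rule: induct_nat_012) (auto simp: algebra_simps)

lemma of_int_lin_rec: "of_int (lin_rec b x y i) = lin_rec b (of_int x) (of_int y) i"
  by (induction i rule: induct_nat_012) auto

text \<open>The digit of index \<open>i\<close>, counted from the right, has weight \<open>lin_rec b x y (Suc i)\<close>: the
  recurrence starts one step early, at \<open>q\<^sub>-\<^sub>1\<close>.\<close>

primrec digit_val :: "(nat \<Rightarrow> int) \<Rightarrow> 'a::comm_ring_1 \<Rightarrow> 'a \<Rightarrow> nat list \<Rightarrow> 'a" where
  "digit_val b x y [] = 0"
| "digit_val b x y (d # w) = of_nat d * lin_rec b x y (Suc (length w)) + digit_val b x y w"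

lemma digit_val_linear:
  "digit_val b (x * u + y * v) (x * u' + y * v') w = x * digit_val b u u' w + y * digit_val b v v' w"
  by (induction w) (simp_all only: digit_val.simps lin_rec_linear, simp_all add: algebra_simps)

lemma of_int_digit_val: "of_int (digit_val b x y w) = digit_val b (of_int x) (of_int y) w"
  by (induction w) (auto simp: of_int_lin_rec)

lemma digit_val_append_shift:
  "digit_val b x y (w @ v) =
     digit_val (\<lambda>i. b (i + length v)) (lin_rec b x y (length v)) (lin_rec b x y (Suc (length v))) w
     + digit_val b x y v"
proof (induction w)
  case (Cons d w)
  have "lin_rec b x y (Suc (length w + length v)) = lin_rec (\<lambda>i. b (i + length v))
      (lin_rec b x y (length v)) (lin_rec b x y (Suc (length v))) (Suc (length w))"
    using lin_rec_shift[of b x y "Suc (length w)" "length v"] by simp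
  with Cons show ?case by (simp add: algebra_simps)
qed simp

lemma digit_val_basis:
  "digit_val b x y w = x * digit_val b 1 0 w + y * digit_val b 0 1 w"
  using digit_val_linear[of b x 1 y 0 0 1 w] by simp

lemma digit_val_eq_sum:
  "digit_val b x y w = (\<Sum>i<length w. of_nat (rev w ! i) * lin_rec b x y (Suc i))"
  by (induction w) (auto simp: nth_append intro!: sum.cong)

lemma digit_val_abs_le:
  fixes x y :: "'a::linordered_idom"
  assumes "w \<in> lists {..A}"
  shows "\<bar>digit_val b x y w\<bar> \<le> of_nat A * (\<Sum>i<length w. \<bar>lin_rec b x y (Suc i)\<bar>)"
  using assms
proof (induction w)
  case (Cons d w)
  have "\<bar>of_nat d * lin_rec b x y (Suc (length w))\<bar> \<le> of_nat A * \<bar>lin_rec b x y (Suc (length w))\<bar>"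
  proof -
    have "d \<le> A" using Cons.hyps by simp
    then show ?thesis unfolding abs_mult by (intro mult_right_mono) auto
  qed
  with Cons show ?case
    by (auto simp: algebra_simps intro: order_trans[OF abs_triangle_ineq])
qed simp

text \<open>\<open>g i\<close> is the tail [0, b i, b (i+1), ...], the inverse of a complete
  quotient; in the application \<open>g 0\<close> is \<gamma>.\<close>

locale periodic_cf =
  fixes b :: "nat \<Rightarrow> int" and g :: "nat \<Rightarrow> real" and P :: nat
  assumes P_pos: "P > 0"
    and b_pos: "b i \<ge> 1"
    and b_periodic: "b (i + P) = b i"
    and g_pos: "g i > 0"
    and g_less_1: "g i < 1"
    and g_step: "1 / g i = of_int (b i) + g (Suc i)"
    and g_periodic: "g (i + P) = g i"
begin

lemma b_mod: "b (i + l mod P) = b (i + l)"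
proof -
  have "b (j + n * P) = b j" for j n
  proof (induction n)
    case (Suc n)
    with b_periodic[of "j + n * P"] show ?case by (simp add: algebra_simps)
  qed simp
  from this[of "i + l mod P" "l div P"] show ?thesis
    by (simp add: add.assoc)
qed

lemma g_mod: "g (l mod P) = g l"
proof -
  have "g (j + n * P) = g j" for j n
  proof (induction n)
    case (Suc n)
    with g_periodic[of "j + n * P"] show ?case by (simp add: algebra_simps)
  qed simp
  from this[of "l mod P" "l div P"] show ?thesis by simp
qed

text \<open>The source of all finiteness: the trailing word acts on the leading digits only through
  its length modulo \<open>P\<close>, two consecutive weights and one additive term.\<close>

lemma digit_val_append:
  "digit_val b x y (w @ v) =
     lin_rec b x y (length v) * digit_val (\<lambda>i. b (i + length v mod P)) 1 0 w +
     lin_rec b x y (Suc (length v)) * digit_val (\<lambda>i. b (i + length v mod P)) 0 1 w +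
     digit_val b x y v"
  unfolding b_mod digit_val_append_shift digit_val_basis[of _ "lin_rec b x y (length v)"] by simp

section \<open>Digit sums modulo \<open>t\<close>\<close>

lemma finite_index_digit_val_mod:
  fixes x y t :: int
  assumes "t > 0"
  shows "finite_index A (\<lambda>w. digit_val b x y w mod t)"
proof (rule finite_indexI)
  \<comment> \<open>By \<open>digit_val_append\<close>, the phase and three residues modulo
    \<open>t\<close> fix the residue of every extension.\<close>
  let ?\<sigma> = "\<lambda>v. (length v mod P, lin_rec b x y (length v) mod t,
    lin_rec b x y (Suc (length v)) mod t, digit_val b x y v mod t)"
  have "?\<sigma> ` lists A \<subseteq> {..<P} \<times> {0..<t} \<times> {0..<t} \<times> {0..<t}"
    using assms P_pos by auto
  then show "finite (?\<sigma> ` lists A)"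
    by (rule finite_subset) auto
  show "digit_val b x y (w @ v) mod t = digit_val b x y (w @ v') mod t" if "?\<sigma> v = ?\<sigma> v'" for v v' w
    using that unfolding digit_val_append
    by (intro mod_add_cong mod_mult_cong) auto
qed

section \<open>Approximation errors and their digit sums\<close>

text \<open>The case \<open>c = 0\<close>, \<open>z = 1\<close> is the sequence \<open>q\<^sub>i \<gamma> - p\<^sub>i\<close> of approximation errors.\<close>

lemma error_Suc:
  "lin_rec (\<lambda>i. b (i + c)) (- z) (g c * z) (Suc i) = - g (i + c) * lin_rec (\<lambda>i. b (i + c)) (- z) (g c * z) i"
proof (induction i)
  case (Suc i)
  let ?f = "lin_rec (\<lambda>i. b (i + c)) (- z) (g c * z)"
  have "?f i = - (of_int (b (i + c)) + g (Suc (i + c))) * ?f (Suc i)"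
    using Suc g_pos[of "i + c"] by (simp flip: g_step)
  then show ?case by (simp add: algebra_simps)
qed simp

text \<open>As \<open>b i\<close> is at least 1, \<open>g i + g i * g (Suc i)\<close> is at most 1.
  Hence each absolute error is at most the difference of its two neighbours, and the sum telescopes.
  The scale \<open>z\<close> is free so that the errors can later be normalised at any
  position.\<close>

lemma error_sum_le:
  "(\<Sum>i<n. \<bar>lin_rec (\<lambda>i. b (i + c)) (- z) (g c * z) (Suc i)\<bar>) \<le> 2 * \<bar>z\<bar>"
proof -
  let ?f = "lin_rec (\<lambda>i. b (i + c)) (- z) (g c * z)"
  have step: "\<bar>?f (Suc i)\<bar> \<le> \<bar>?f i\<bar> - \<bar>?f (Suc (Suc i))\<bar>" for i
  proof -
    have "1 = g (i + c) * (of_int (b (i + c)) + g (Suc (i + c)))"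
      using g_pos[of "i + c"] by (simp flip: g_step)
    moreover have "g (i + c) * 1 \<le> g (i + c) * of_int (b (i + c))"
      using b_pos[of "i + c"] g_pos[of "i + c"] by (intro mult_left_mono) auto
    ultimately have "g (i + c) + g (Suc (i + c)) * g (i + c) \<le> 1"
      by (simp add: algebra_simps)
    then have "(g (i + c) + g (Suc (i + c)) * g (i + c)) * \<bar>?f i\<bar> \<le> 1 * \<bar>?f i\<bar>"
      by (intro mult_right_mono) auto
    moreover have "\<bar>?f (Suc i)\<bar> = g (i + c) * \<bar>?f i\<bar>"
      using g_pos[of "i + c"] by (simp only: error_Suc abs_mult abs_minus_cancel abs_of_pos)
    moreover have "\<bar>?f (Suc (Suc i))\<bar> = g (Suc (i + c)) * \<bar>?f (Suc i)\<bar>"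
      using g_pos[of "Suc (i + c)"]
      by (simp only: error_Suc[of _ _ "Suc i"] abs_mult abs_minus_cancel abs_of_pos add_Suc)
    ultimately show ?thesis by (simp add: algebra_simps)
  qed
  have "(\<Sum>i<n. \<bar>?f (Suc i)\<bar>) \<le> \<bar>?f 0\<bar> + \<bar>?f 1\<bar> - \<bar>?f n\<bar> - \<bar>?f (Suc n)\<bar>"
  proof (induction n)
    case (Suc n)
    with step[of n] show ?case unfolding sum.lessThan_Suc by simp
  qed simp
  also have "\<dots> \<le> \<bar>?f 0\<bar> + \<bar>?f 1\<bar>" by linarith
  also have "\<dots> \<le> 2 * \<bar>z\<bar>"
    using g_pos[of c] g_less_1[of c] mult_right_mono[of "g c" 1 "\<bar>z\<bar>"] by (simp add: abs_mult)
  finally show ?thesis .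
qed

lemma error_digit_val_le:
  assumes "w \<in> lists {..A}"
  shows "\<bar>digit_val (\<lambda>i. b (i + c)) (- z) (g c * z) w\<bar> \<le> 2 * real A * \<bar>z\<bar>"
  using digit_val_abs_le[OF assms, of "\<lambda>i. b (i + c)" "- z" "g c * z"]
    mult_left_mono[OF error_sum_le[of c z "length w"], of "real A"] by simp

lemma error_nonzero: "lin_rec b (- 1) (g 0) i \<noteq> 0"
proof (induction i)
  case (Suc i)
  have "lin_rec b (- 1) (g 0) (Suc i) = - g i * lin_rec b (- 1) (g 0) i"
    using error_Suc[of 0 1 i] by simp
  then show ?case using Suc g_pos[of i] by simp
qed simp

section \<open>Growth of the convergent denominators\<close>

lemma denom_step:
  assumes "0 \<le> lin_rec b 0 (1::int) (Suc i)"
  shows "lin_rec b 0 (1::int) (Suc i) + lin_rec b 0 1 i \<le> lin_rec b 0 1 (Suc (Suc i))"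
  using mult_right_mono[OF b_pos[of i] assms] by simp

lemma denom_bounds:
  "0 \<le> lin_rec b 0 (1::int) i \<and> lin_rec b 0 (1::int) i \<le> lin_rec b 0 1 (Suc i) \<and> 1 \<le> lin_rec b 0 (1::int) (Suc i)"
proof (induction i)
  case (Suc i)
  with denom_step[of i] show ?case by (simp del: lin_rec.simps(3))
qed simp

text \<open>Fibonacci-like growth: each weight is at least the sum of the two before it, so all
  earlier weights together are at most twice the next one.\<close>

lemma denom_sum_le:
  "(\<Sum>i<n. \<bar>lin_rec b 0 (1::int) (Suc i)\<bar>) \<le> 2 * lin_rec b 0 1 (Suc n)"
proof -
  let ?q = "lin_rec b 0 (1::int)"
  have "(\<Sum>i<n. \<bar>?q (Suc i)\<bar>) \<le> ?q n + ?q (Suc n)"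
  proof (induction n)
    case (Suc n)
    with denom_step[of n] denom_bounds[of n] show ?case by (simp del: lin_rec.simps(3))
  qed simp
  with denom_bounds[of n] show ?thesis by simp
qed

lemma denom_digit_val_le:
  assumes "w \<in> lists {..A}"
  shows "\<bar>digit_val b 0 (1::int) w\<bar> \<le> 2 * int A * lin_rec b 0 1 (Suc (length w))"
  using digit_val_abs_le[OF assms, of b 0 "1::int"]
    mult_left_mono[OF denom_sum_le[of "length w"], of "int A"] by simp

section \<open>Comparing error digit sums with elements of \<int> + \<int>\<gamma>\<close>

lemma error_eq: "lin_rec b (- 1) (g 0) i = of_int (lin_rec b (- 1) 0 i) + of_int (lin_rec b 0 1 i) * g 0"
  using lin_rec_linear[of b 1 "-1" "g 0" 0 0 1 i] by (simp add: of_int_lin_rec)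

lemma error_digit_val_eq:
  "digit_val b (- 1) (g 0) w = of_int (digit_val b (- 1) 0 w) + of_int (digit_val b 0 1 w) * g 0"
  using digit_val_linear[of b 1 "-1" "g 0" 0 0 1 w] by (simp add: of_int_digit_val)

text \<open>Consecutive vectors (-p_i, q_i) form a basis of the integer lattice. In the induction
  the older vector is replaced by the newest minus \<open>b l\<close> times the middle one, which
  yields the new coefficients.\<close>

lemma lattice_basis:
  fixes U V :: int
  shows "\<exists>m m'. U = m * lin_rec b (- 1) 0 (Suc l) + m' * lin_rec b (- 1) 0 l \<and>
               V = m * lin_rec b 0 1 (Suc l) + m' * lin_rec b 0 1 l"
proof (induction l)
  case 0
  show ?case by (rule exI[of _ V], rule exI[of _ "- U"]) simp
next
  case (Suc l)
  then obtain m m' where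
    "U = m * lin_rec b (- 1) 0 (Suc l) + m' * lin_rec b (- 1) 0 l"
    "V = m * lin_rec b 0 1 (Suc l) + m' * lin_rec b 0 1 l" by blast
  then show ?case
    by (intro exI[of _ m'] exI[of _ "m - b l * m'"]) (simp add: algebra_simps)
qed

text \<open>Dividing by the error at position \<open>l = length v\<close> turns the comparison into one between a
  bounded quantity depending on the leading digits \<open>w\<close> only and a number \<open>m - m' / g l\<close> with
  integers \<open>m\<close>, \<open>m'\<close>. The growth of the \<open>q\<^sub>i\<close> bounds a second combination of \<open>m\<close> and
  \<open>m'\<close>, so that only finitely many of these numbers matter.\<close>

lemma finite_index_error_less:
  fixes s u x :: int
  shows "finite_index {..A} (\<lambda>w. of_int s * digit_val b (- 1) (g 0) w < of_int u + of_int x * g 0)"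
    (is "finite_index _ (\<lambda>w. _ * ?D w < ?\<theta>)")
proof (rule finite_indexI)
  define G where "G = (\<Sum>c<P. 1 / g c)"
  \<comment> \<open>Chosen to exceed \<open>\<bar>s * e c w\<bar>\<close> for every phase and every
    word; the summand 1 makes this strict.\<close>
  define C where "C = 2 * \<bar>real_of_int s\<bar> * A * G + 1"
  \<comment> \<open>What is left of the threshold after the digits of \<open>v\<close>, in units of
    the error that weights the next digit.\<close>
  define \<xi> where "\<xi> v = (?\<theta> - s * ?D v) / lin_rec b (- 1) (g 0) (Suc (length v))" for v
  define clip where "clip z = max (- C) (min C z)" for z :: real
  \<comment> \<open>The error digit sum rescaled so that the last digit of \<open>w\<close> has
    weight 1, which is the case \<open>z = 1 / g c\<close> of the error sequence.\<close>
  define e where "e c w = digit_val (\<lambda>i. b (i + c)) (- (1 / g c)) 1 w" for c w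
  \<comment> \<open>The sign of the error fixes the direction of the inequality after division. A
    threshold beyond \<open>C\<close> in absolute value decides the comparison by its sign alone, so
    clipping loses nothing.\<close>
  let ?\<sigma> = "\<lambda>v. (length v mod P, 0 < lin_rec b (- 1) (g 0) (Suc (length v)), clip (\<xi> v))"
  have G: "1 / g l \<le> G" for l
  proof -
    have "1 / g (l mod P) \<le> G"
      unfolding G_def using P_pos g_pos by (intro member_le_sum) (auto simp: less_imp_le)
    then show ?thesis by (simp add: g_mod)
  qed
  have G0: "0 \<le> G" using G[of 0] g_pos[of 0] by (smt (verit) divide_pos_pos)
  have C_pos: "C > 0" unfolding C_def using G0 by (smt (verit) mult_nonneg_nonneg of_nat_0_le_iff)
  have e_less: "\<bar>s * e c w\<bar> < C" if "w \<in> lists {..A}" for c w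
  proof -
    have "\<bar>e c w\<bar> \<le> 2 * real A * (1 / g c)"
      using error_digit_val_le[OF that, of c "1 / g c"] g_pos[of c] by (simp add: e_def)
    also have "\<dots> \<le> 2 * real A * G" by (intro mult_left_mono G) auto
    finally have "\<bar>real_of_int s\<bar> * \<bar>e c w\<bar> \<le> \<bar>real_of_int s\<bar> * (2 * real A * G)"
      by (intro mult_left_mono) auto
    then show ?thesis by (simp add: C_def abs_mult algebra_simps)
  qed
  \<comment> \<open>\<open>C2\<close> bounds the coefficient of \<open>g 0\<close> in the remaining
    threshold relative to the next denominator; \<open>B\<close> will bound both integers
    \<open>m\<close> and \<open>m'\<close>.\<close>
  define C2 where "C2 = \<bar>real_of_int x\<bar> + 2 * \<bar>real_of_int s\<bar> * A"
  define B where "B = \<lceil>2 * C2 + C\<rceil>"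
  let ?Y = "(\<lambda>(m, m', c). of_int m - of_int m' / g c) ` ({-B..B} \<times> {-B..B} \<times> {..<P})"
  have small_\<xi>: "\<xi> v \<in> ?Y" if v: "v \<in> lists {..A}" and le: "\<bar>\<xi> v\<bar> \<le> C" for v
  proof -
    define l where "l = length v"
    let ?q = "lin_rec b 0 (1::int)" and ?p = "lin_rec b (- 1) (0::int)" and ?d = "lin_rec b (- 1) (g 0)"
    obtain m m' where m: "u - s * digit_val b (- 1) 0 v = m * ?p (Suc l) + m' * ?p l"
      "x - s * digit_val b 0 1 v = m * ?q (Suc l) + m' * ?q l"
      using lattice_basis by blast
    have "?\<theta> - s * ?D v = real_of_int (u - s * digit_val b (- 1) 0 v) + real_of_int (x - s * digit_val b 0 1 v) * g 0"
      by (simp add: error_digit_val_eq algebra_simps)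
    also have "\<dots> = m * ?d (Suc l) + m' * ?d l"
      unfolding m by (simp add: error_eq algebra_simps)
    finally have "\<xi> v = (m * ?d (Suc l) + m' * ?d l) / ?d (Suc l)"
      by (simp add: \<xi>_def l_def)
    moreover have "?d l = - ?d (Suc l) / g l"
      using error_Suc[of 0 1 l] g_pos[of l] by simp
    ultimately have \<xi>_eq: "\<xi> v = m - m' / g l"
      using error_nonzero[of "Suc l"] by (simp add: diff_divide_distrib del: lin_rec.simps)
    \<comment> \<open>The coefficient of \<open>g 0\<close>, divided by the next denominator, is a
      second linear form \<open>m + m' * \<rho>\<close>, bounded by \<open>C2\<close>.\<close>
    define \<rho> where "\<rho> = real_of_int (?q l) / real_of_int (?q (Suc l))"
    have q1: "?q (Suc l) \<ge> 1" and \<rho>: "0 \<le> \<rho>" "\<rho> \<le> 1"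
      using denom_bounds[of l] by (auto simp: \<rho>_def)
    have "\<bar>x - s * digit_val b 0 1 v\<bar> \<le> \<bar>x\<bar> + \<bar>s\<bar> * \<bar>digit_val b 0 1 v\<bar>"
      by (metis abs_mult abs_triangle_ineq4)
    also have "\<dots> \<le> \<bar>x\<bar> * ?q (Suc l) + \<bar>s\<bar> * (2 * int A * ?q (Suc l))"
      using denom_digit_val_le[OF v] q1 mult_left_mono[of 1 "?q (Suc l)" "\<bar>x\<bar>"]
      by (intro add_mono mult_left_mono) (auto simp: l_def)
    finally have "\<bar>m * ?q (Suc l) + m' * ?q l\<bar> \<le> (\<bar>x\<bar> + 2 * \<bar>s\<bar> * int A) * ?q (Suc l)"
      using m(2) by (simp add: algebra_simps)
    then have "real_of_int \<bar>m * ?q (Suc l) + m' * ?q l\<bar> \<le> real_of_int ((\<bar>x\<bar> + 2 * \<bar>s\<bar> * int A) * ?q (Suc l))"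
      by (simp only: of_int_le_iff)
    moreover have "(m + m' * \<rho>) * ?q (Suc l) = real_of_int (m * ?q (Suc l) + m' * ?q l)"
      using q1 by (simp add: \<rho>_def distrib_right)
    ultimately have "\<bar>(m + m' * \<rho>) * ?q (Suc l)\<bar> \<le> C2 * ?q (Suc l)"
      by (simp add: C2_def)
    then have mm: "\<bar>m + m' * \<rho>\<bar> \<le> C2"
      using q1 by (simp add: abs_mult)
    \<comment> \<open>The two forms differ by \<open>m' * (\<rho> + 1 / g l)\<close>, and this
      factor exceeds 1; so \<open>m'\<close> is bounded, and then \<open>m\<close> as well.\<close>
    have "\<bar>m' * (\<rho> + 1 / g l)\<bar> \<le> C2 + C"
      using mm le unfolding \<xi>_eq by (simp add: algebra_simps)
    moreover have "1 < 1 / g l" using g_pos[of l] g_less_1[of l] by simp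
    then have "\<bar>real_of_int m'\<bar> * 1 \<le> \<bar>real_of_int m'\<bar> * (\<rho> + 1 / g l)"
      using \<rho> by (intro mult_left_mono) auto
    ultimately have m'_le: "\<bar>real_of_int m'\<bar> \<le> C2 + C"
      using \<rho> g_pos[of l] by (simp add: abs_mult)
    have "\<bar>m' * \<rho>\<bar> \<le> \<bar>real_of_int m'\<bar>"
      using \<rho> mult_left_mono[of \<rho> 1 "\<bar>real_of_int m'\<bar>"] by (simp add: abs_mult)
    with mm m'_le have m_le: "\<bar>real_of_int m\<bar> \<le> 2 * C2 + C" by linarith
    have "C2 \<ge> 0" by (simp add: C2_def)
    with m'_le m_le have "m \<in> {-B..B}" "m' \<in> {-B..B}" unfolding B_def
      by (auto simp: le_ceiling_iff minus_le_iff ceiling_le_iff)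
    moreover have "\<xi> v = m - m' / g (l mod P)" "l mod P \<in> {..<P}"
      using \<xi>_eq P_pos by (auto simp: g_mod)
    ultimately show ?thesis by force
  qed
  have clip: "clip (\<xi> v) \<in> {-C, C} \<union> ?Y" if v: "v \<in> lists {..A}" for v
  proof (cases "\<bar>\<xi> v\<bar> \<le> C")
    case True
    then have "clip (\<xi> v) = \<xi> v" by (auto simp: clip_def)
    with small_\<xi>[OF v True] show ?thesis by (simp only: Un_iff simp_thms)
  next
    case False
    then have "clip (\<xi> v) \<in> {-C, C}"
      using C_pos by (auto simp: clip_def max_def min_def)
    then show ?thesis by blast
  qed
  have "?\<sigma> ` lists {..A} \<subseteq> {..<P} \<times> UNIV \<times> ({-C, C} \<union> ?Y)"
    by (intro image_subsetI SigmaI) (simp add: P_pos, simp, rule clip)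
  then show "finite (?\<sigma> ` lists {..A})"
    by (rule finite_subset) auto
  have key: "s * ?D (w @ v) < ?\<theta> \<longleftrightarrow>
      (if 0 < lin_rec b (- 1) (g 0) (Suc (length v)) then s * e (length v mod P) w < clip (\<xi> v)
       else s * e (length v mod P) w > clip (\<xi> v))"
    if "w \<in> lists {..A}" for v w
  proof -
    define l where "l = length v"
    define d where "d = lin_rec b (- 1) (g 0) (Suc l)"
    let ?b = "\<lambda>i. b (i + l mod P)"
    have d: "d \<noteq> 0" "lin_rec b (- 1) (g 0) l = d * - (1 / g l)"
      using error_nonzero[of "Suc l"] error_Suc[of 0 1 l] g_pos[of l] by (auto simp: d_def)
    have "?D (w @ v) = d * (- (1 / g l) * digit_val ?b 1 0 w + 1 * digit_val ?b 0 1 w) + ?D v"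
      unfolding digit_val_append l_def[symmetric] d(2) unfolding d_def by (simp add: algebra_simps)
    also have "- (1 / g l) * digit_val ?b 1 0 w + 1 * digit_val ?b 0 1 w = e (l mod P) w"
      unfolding e_def g_mod by (subst (3) digit_val_basis) simp
    finally have "s * ?D (w @ v) < ?\<theta> \<longleftrightarrow> d * (s * e (l mod P) w) < d * \<xi> v"
      using d(1) by (simp add: \<xi>_def d_def l_def algebra_simps)
    also have "\<dots> \<longleftrightarrow> (if 0 < d then s * e (l mod P) w < \<xi> v else s * e (l mod P) w > \<xi> v)"
      using d(1) by (auto simp: mult_less_cancel_left)
    also have "\<dots> \<longleftrightarrow> (if 0 < d then s * e (l mod P) w < clip (\<xi> v) else s * e (l mod P) w > clip (\<xi> v))"
      using e_less[OF that, of "l mod P"] unfolding clip_def by (auto simp: max_def min_def)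
    finally show ?thesis by (simp add: d_def l_def)
  qed
  show "(s * ?D (w @ v) < ?\<theta>) = (s * ?D (w @ v') < ?\<theta>)"
    if "w \<in> lists {..A}" "?\<sigma> v = ?\<sigma> v'" for v v' w
    using that(2) unfolding key[OF that(1)] by simp
qed

section \<open>Distance to the nearest integer as a finite Boolean combination\<close>

lemma finite_index_near_int:
  fixes r s t :: int
  assumes "t > 0" and \<beta>: "\<beta> = (of_int r + of_int s * g 0) / of_int t"
  shows "finite_index {..A} (\<lambda>w. w \<in> lists {..A} \<and>
           (\<exists>k::int. \<bar>of_int (digit_val b 0 1 w) * \<beta> - of_int k\<bar> < \<beta>))"
proof -
  let ?D = "digit_val b (- 1) (g 0)"
  \<comment> \<open>Since \<open>\<bar>?D w\<bar>\<close> is at most \<open>2 * A\<close>, every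
    \<open>z\<close> that satisfies the inequalities below lies between \<open>- Z\<close> and
    \<open>Z\<close>.\<close>
  define Z where "Z = \<lceil>of_int r + of_int s * g 0 + 2 * \<bar>real_of_int s\<bar> * A\<rceil>"
  \<comment> \<open>With N and M as in the overview, \<open>digit_val b s r w\<close> is r * N + s *
    M. Writing z for this number minus t * k gives t * (N * \<beta> - k) = z + s * D; the two
    inequalities say that its absolute value is below t * \<beta>.\<close>
  define F where "F z w \<longleftrightarrow> digit_val b s r w mod t = z mod t \<and>
     of_int s * ?D w < of_int (r - z) + of_int s * g 0 \<and>
     of_int (- s) * ?D w < of_int (r + z) + of_int s * g 0" for z w
  have "finite_index {..A} (F z)" for z
    unfolding F_def
    by (intro finite_index_compose2[where H = "\<lambda>x y. x \<and> y"] finite_index_error_less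
        finite_index_compose2[where H = "\<lambda>x y. x = y"] finite_index_digit_val_mod finite_index_const assms(1))
  then have "finite_index {..A} (\<lambda>w. w \<in> lists {..A} \<and> (\<exists>z\<in>{-Z..Z}. F z w))"
    by (intro finite_index_compose2[where H = "\<lambda>x y. x \<and> y"] finite_index_Bex)
      (auto intro!: finite_indexI[where \<sigma> = "\<lambda>v. v \<in> lists {..A}"])
  moreover have "(\<exists>z\<in>{-Z..Z}. F z w) \<longleftrightarrow> (\<exists>k::int. \<bar>of_int (digit_val b 0 1 w) * \<beta> - of_int k\<bar> < \<beta>)"
    if w: "w \<in> lists {..A}" for w
  proof -
    let ?N = "digit_val b 0 1 w :: int" and ?E = "digit_val b s r w"
    have E: "real_of_int ?E = of_int r * of_int ?N - of_int s * of_int (digit_val b (- 1) 0 w)"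
      using digit_val_linear[of b r 0 "- s" "-1" 1 0 w] by (simp flip: of_int_mult of_int_diff)
    have "\<bar>?N * \<beta> - k\<bar> < \<beta> \<longleftrightarrow> \<bar>?N * \<beta> - k\<bar> * t < \<beta> * t" for k :: int
      using assms(1) by simp
    also have "\<beta> * t = r + s * g 0" using assms by simp
    also have "\<bar>?N * \<beta> - k\<bar> * t = \<bar>real_of_int (?E - t * k) + s * ?D w\<bar>" for k
    proof -
      have "\<bar>?N * \<beta> - k\<bar> * t = \<bar>(?N * \<beta> - k) * t\<bar>"
        using assms(1) by (simp add: abs_mult)
      also have "(?N * \<beta> - k) * t = ?N * (\<beta> * t) - t * k" by (simp add: algebra_simps)
      also have "\<beta> * t = r + s * g 0" using assms by simp
      also have "?N * (r + s * g 0) - t * k = real_of_int (?E - t * k) + s * ?D w"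
        by (simp add: E error_digit_val_eq algebra_simps)
      finally show ?thesis .
    qed
    finally have near: "\<bar>?N * \<beta> - k\<bar> < \<beta> \<longleftrightarrow> \<bar>real_of_int (?E - t * k) + s * ?D w\<bar> < r + s * g 0" for k .
    have F: "F z w \<longleftrightarrow> ?E mod t = z mod t \<and> \<bar>real_of_int z + s * ?D w\<bar> < r + s * g 0" for z
      unfolding F_def by (auto simp: abs_less_iff)
    show ?thesis
    proof
      assume "\<exists>z\<in>{-Z..Z}. F z w"
      then obtain z where z: "?E mod t = z mod t" "\<bar>real_of_int z + s * ?D w\<bar> < r + s * g 0"
        unfolding F by blast
      then obtain k where "?E - t * k = z"
        by (metis mod_eq_dvd_iff dvdE diff_diff_eq2 add_diff_cancel_left')
      with z(2) show "\<exists>k::int. \<bar>?N * \<beta> - k\<bar> < \<beta>" unfolding near by metis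
    next
      assume "\<exists>k::int. \<bar>?N * \<beta> - k\<bar> < \<beta>"
      then obtain k where k: "\<bar>real_of_int (?E - t * k) + s * ?D w\<bar> < r + s * g 0"
        unfolding near by blast
      have "\<bar>?D w\<bar> \<le> 2 * real A"
        using error_digit_val_le[OF w, of 0 1] by simp
      then have "\<bar>real_of_int s\<bar> * \<bar>?D w\<bar> \<le> \<bar>real_of_int s\<bar> * (2 * A)"
        by (intro mult_left_mono) auto
      then have "\<bar>s * ?D w\<bar> \<le> 2 * \<bar>real_of_int s\<bar> * A"
        by (simp add: abs_mult)
      with k have "\<bar>real_of_int (?E - t * k)\<bar> \<le> r + s * g 0 + 2 * \<bar>real_of_int s\<bar> * A"
        by linarith
      then have "?E - t * k \<in> {-Z..Z}"
        unfolding Z_def by (auto simp: le_ceiling_iff minus_le_iff)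
      moreover have "F (?E - t * k) w" using k unfolding F by (simp add: mod_eq_dvd_iff)
      ultimately show "\<exists>z\<in>{-Z..Z}. F z w" by blast
    qed
  qed
  ultimately show ?thesis by (simp cong: conj_cong)
qed

text \<open>Serves the case \<open>\<alpha> = 0\<close>, where the sums complement consists of all
  positive integers.\<close>

lemma digit_val_eq_0_iff: "digit_val b 0 (1::int) w = 0 \<longleftrightarrow> set w \<subseteq> {0}"
proof (induction w)
  case (Cons d w)
  have "0 \<le> digit_val b 0 (1::int) w"
    unfolding digit_val_eq_sum using denom_bounds by (intro sum_nonneg mult_nonneg_nonneg) (auto intro: order_trans[OF zero_le_one])
  moreover have "lin_rec b 0 (1::int) (Suc (length w)) \<ge> 1"
    using denom_bounds by blast
  ultimately show ?case
    using Cons by (auto simp: add_nonneg_eq_0_iff)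
qed simp

end

section \<open>Sums complements and nearest integers\<close>

text \<open>For rational \<alpha> a multiple by the denominator has fractional part 0; for
  irrational \<alpha> Kronecker's theorem applies.\<close>

lemma frac_multiple_less:
  fixes \<alpha> \<eta> :: real
  assumes "\<eta> > 0"
  obtains J :: nat where "J \<ge> 1" "frac (real J * \<alpha>) < \<eta>"
proof (cases "\<alpha> \<in> \<rat>")
  case True
  then obtain p q :: int where "q > 0" "\<alpha> = p / q" by (rule Rats_cases')
  then have "real (nat q) * \<alpha> = of_int p" by simp
  with \<open>q > 0\<close> assms show ?thesis by (intro that[of "nat q"]) (auto simp del: of_nat_nat)
next
  case False
  then obtain k where "k > 0" "\<bar>frac (real k * \<alpha>) - 0\<bar> < \<eta>"
    using Kronecker_approx_1_explicit[of \<alpha> 0 \<eta>] assms by auto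
  then show ?thesis by (intro that[of k]) auto
qed

text \<open>With k = i - j, the number n - k * \<alpha> is a difference of two fractional parts.
  Conversely, j can be chosen so that adding k * \<alpha> to j * \<alpha> carries or does not carry
  into the integer part, as required.\<close>

lemma Beatty_difference_iff:
  fixes \<alpha> :: real and n :: nat
  assumes "\<alpha> > 0" "n \<ge> 1"
  shows "(\<exists>i j :: nat. i \<ge> 1 \<and> j \<ge> 1 \<and> int n = \<lfloor>real i * \<alpha>\<rfloor> - \<lfloor>real j * \<alpha>\<rfloor>) \<longleftrightarrow>
         (\<exists>k :: int. \<bar>real n - of_int k * \<alpha>\<bar> < 1)"
proof
  assume "\<exists>i j :: nat. i \<ge> 1 \<and> j \<ge> 1 \<and> int n = \<lfloor>real i * \<alpha>\<rfloor> - \<lfloor>real j * \<alpha>\<rfloor>"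
  then obtain i j :: nat where ij: "int n = \<lfloor>real i * \<alpha>\<rfloor> - \<lfloor>real j * \<alpha>\<rfloor>" by blast
  have "real n = real_of_int (int n)" by simp
  also have "\<dots> = (real i * \<alpha> - frac (real i * \<alpha>)) - (real j * \<alpha> - frac (real j * \<alpha>))"
    unfolding ij by (simp add: frac_def)
  finally have "real n - of_int (int i - int j) * \<alpha> = frac (real j * \<alpha>) - frac (real i * \<alpha>)"
    by (simp add: algebra_simps)
  then have "\<bar>real n - of_int (int i - int j) * \<alpha>\<bar> < 1"
    using frac_ge_0[of "real i * \<alpha>"] frac_ge_0[of "real j * \<alpha>"]
      frac_lt_1[of "real i * \<alpha>"] frac_lt_1[of "real j * \<alpha>"] by linarith
  then show "\<exists>k :: int. \<bar>real n - of_int k * \<alpha>\<bar> < 1" by blast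
next
  assume "\<exists>k :: int. \<bar>real n - of_int k * \<alpha>\<bar> < 1"
  then obtain k' :: int where k': "\<bar>real n - of_int k' * \<alpha>\<bar> < 1" by blast
  with assms(2) have "0 < of_int k' * \<alpha>" by linarith
  with assms(1) have "k' > 0" by (simp add: zero_less_mult_iff)
  then obtain k :: nat where "k' = int k" "k \<ge> 1"
    by (metis zero_less_imp_eq_int of_nat_0_less_iff Suc_leI One_nat_def)
  with k' have k: "\<bar>real n - real k * \<alpha>\<bar> < 1" by simp
  define x where "x = frac (real k * \<alpha>)"
  have x: "0 \<le> x" "x < 1" "real k * \<alpha> = of_int \<lfloor>real k * \<alpha>\<rfloor> + x"
    using frac_lt_1[of "real k * \<alpha>"] by (simp_all add: x_def frac_def)
  consider "int n = \<lfloor>real k * \<alpha>\<rfloor>" | "int n = \<lfloor>real k * \<alpha>\<rfloor> + 1" "x > 0"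
    using k x by linarith
  then show "\<exists>i j :: nat. i \<ge> 1 \<and> j \<ge> 1 \<and> int n = \<lfloor>real i * \<alpha>\<rfloor> - \<lfloor>real j * \<alpha>\<rfloor>"
  proof cases
    case 1
    obtain J :: nat where J: "J \<ge> 1" "frac (real J * \<alpha>) < 1 - x"
      using frac_multiple_less[of "1 - x" \<alpha>] x(2) by auto
    have "\<lfloor>real (J + k) * \<alpha>\<rfloor> = \<lfloor>real J * \<alpha>\<rfloor> + \<lfloor>real k * \<alpha>\<rfloor>"
      using J(2) floor_add[of "real J * \<alpha>" "real k * \<alpha>"] by (simp add: x_def distrib_right)
    with 1 J(1) show ?thesis
      by (intro exI[of _ "J + k"] exI[of _ J]) auto
  next
    case 2
    \<comment> \<open>The factor \<open>k + 1\<close> makes the index exceed \<open>k\<close>, and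
      dividing the bound by it keeps the fractional part of the multiple below \<open>x\<close>. A
      sum whose fractional part is below that of a summand must have carried.\<close>
    obtain J\<^sub>0 :: nat where J0: "J\<^sub>0 \<ge> 1" "frac (real J\<^sub>0 * \<alpha>) < x / real (k + 1)"
      using frac_multiple_less[of "x / real (k + 1)" \<alpha>] 2(2) by auto
    define J where "J = J\<^sub>0 * (k + 1)"
    have "k < J" using J0(1) mult_right_mono[of 1 J\<^sub>0 "k + 1"] by (simp add: J_def)
    have "real (k + 1) * frac (real J\<^sub>0 * \<alpha>) < x"
      using J0(2) by (simp add: field_simps)
    moreover have "frac (real J * \<alpha>) = real (k + 1) * frac (real J\<^sub>0 * \<alpha>)"
    proof -
      have "real J * \<alpha> - real (k + 1) * frac (real J\<^sub>0 * \<alpha>) = of_int (int (k + 1) * \<lfloor>real J\<^sub>0 * \<alpha>\<rfloor>)"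
        by (simp add: J_def frac_def algebra_simps)
      then show ?thesis
        using calculation x(2) frac_ge_0[of "real J\<^sub>0 * \<alpha>"] by (intro frac_unique_iff[THEN iffD2] conjI) auto
    qed
    ultimately have "frac (real J * \<alpha>) < x" by simp
    moreover have J: "real J * \<alpha> = real (J - k) * \<alpha> + real k * \<alpha>"
      using \<open>k < J\<close> by (simp add: of_nat_diff algebra_simps)
    moreover have "frac (real (J - k) * \<alpha> + real k * \<alpha>) \<ge> x"
      if "frac (real (J - k) * \<alpha>) + frac (real k * \<alpha>) < 1"
      using that by (simp add: frac_add x_def)
    ultimately have "\<not> frac (real (J - k) * \<alpha>) + frac (real k * \<alpha>) < 1"
      by (metis not_le)
    then have "\<lfloor>real J * \<alpha>\<rfloor> = \<lfloor>real (J - k) * \<alpha>\<rfloor> + \<lfloor>real k * \<alpha>\<rfloor> + 1"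
      unfolding J floor_add by simp
    with 2(1) \<open>k < J\<close> show ?thesis
      by (intro exI[of _ J] exI[of _ "J - k"]) auto
  qed
qed

lemma sums_complement_iff:
  assumes "\<alpha> > 0"
  shows "n \<in> sums_complement \<alpha> \<longleftrightarrow> \<not> (\<exists>k :: int. \<bar>real n * (1 / \<alpha>) - of_int k\<bar> < 1 / \<alpha>)"
proof -
  have scale: "\<bar>real n - of_int k * \<alpha>\<bar> < 1 \<longleftrightarrow> \<bar>real n * (1 / \<alpha>) - of_int k\<bar> < 1 / \<alpha>" for k
  proof -
    have "\<bar>real n - of_int k * \<alpha>\<bar> = \<bar>(real n * (1 / \<alpha>) - of_int k) * \<alpha>\<bar>"
      using assms by (simp add: field_simps)
    also have "\<dots> = \<bar>real n * (1 / \<alpha>) - of_int k\<bar> * \<alpha>"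
      using assms by (simp only: abs_mult abs_of_pos)
    finally show ?thesis using assms by (simp add: pos_less_divide_eq)
  qed
  show ?thesis
  proof (cases "n \<ge> 1")
    case True
    with Beatty_difference_iff[OF assms True] show ?thesis
      by (simp only: sums_complement_def mem_Collect_eq scale simp_thms)
  next
    case False
    then have "n = 0" by simp
    \<comment> \<open>Zero is outside the sums complement, and on the right \<open>k = 0\<close>
      works because \<open>1 / \<alpha>\<close> is positive.\<close>
    then show ?thesis using assms by (auto simp: sums_complement_def intro!: exI[of _ 0])
  qed
qed

section \<open>Real quadratic fields and continued fractions\<close>

lemma rat_adjoin_cases:
  assumes "quadratic_irrational \<gamma>" "z \<in> rat_adjoin \<gamma>"
  shows "\<exists>x\<in>\<rat>. \<exists>y\<in>\<rat>. z = x + y * \<gamma>"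
proof -
  interpret R: field "ring_of_type_algebra :: real ring" by rule
  have ops: "a_inv (ring_of_type_algebra :: real ring) h = - h"
    "h \<noteq> 0 \<Longrightarrow> m_inv (ring_of_type_algebra :: real ring) h = inverse h" for h :: real
    by (intro R.minus_equality R.comm_inv_char; simp add: ring_of_type_algebra_def)+
  obtain a b c :: int where irr: "\<gamma> \<notin> \<rat>" and "a \<noteq> 0" "a * \<gamma>\<^sup>2 + b * \<gamma> + c = 0"
    using assms(1) unfolding quadratic_irrational_def by blast
  then have "\<gamma> * \<gamma> = (- b / a) * \<gamma> + (- c / a)"
    by (simp add: power2_eq_square field_simps)
  then obtain B C where BC: "B \<in> \<rat>" "C \<in> \<rat>" "\<gamma> * \<gamma> = B * \<gamma> + C"
    by (metis Rats_divide Rats_minus_iff Rats_of_int)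
  show ?thesis
    using assms(2) unfolding rat_adjoin_def
  proof (induction rule: generate_field.induct)
    case one
    show ?case by (rule bexI[of _ 1], rule bexI[of _ 0]) (auto simp: ring_of_type_algebra_def)
  next
    case (incl h)
    then show ?case by (intro bexI[of _ 0] bexI[of _ 1]) auto
  next
    case (a_inv h)
    then obtain x y where "x \<in> \<rat>" "y \<in> \<rat>" "h = x + y * \<gamma>" by blast
    then show ?case by (intro bexI[of _ "- x"] bexI[of _ "- y"]) (auto simp: ops)
  next
    case (m_inv h)
    then obtain x y where xy: "x \<in> \<rat>" "y \<in> \<rat>" "h = x + y * \<gamma>" by blast
    have h: "h \<noteq> 0" using m_inv by (simp add: ring_of_type_algebra_def)
    \<comment> \<open>The other root of the quadratic is \<open>B - \<gamma>\<close>, so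
      \<open>?h'\<close> is the conjugate of \<open>h\<close> and \<open>?N\<close> its
      norm.\<close>
    let ?h' = "x + y * B - y * \<gamma>" and ?N = "x * x + x * y * B - y * y * C"
    have N: "h * ?h' = ?N"
    proof -
      have "h * ?h' = x * x + x * y * B + y * y * B * \<gamma> - y * y * (\<gamma> * \<gamma>)"
        unfolding xy by (simp add: algebra_simps)
      then show ?thesis unfolding BC by (simp add: algebra_simps)
    qed
    have "?h' \<noteq> 0"
    proof
      assume "?h' = 0"
      moreover have "y \<noteq> 0" using h \<open>?h' = 0\<close> xy by auto
      ultimately have "\<gamma> = (x + y * B) / y" by (simp add: field_simps)
      with xy BC irr show False by simp
    qed
    with N h have "?N \<noteq> 0" by (metis mult_eq_0_iff)
    then have "inverse h = ?h' / ?N"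
      by (intro inverse_unique) (simp only: times_divide_eq_right N divide_self simp_thms)
    also have "\<dots> = (x + y * B) / ?N + (- y / ?N) * \<gamma>"
      by (simp add: diff_divide_distrib)
    finally show ?case
      using xy BC h by (intro bexI[of _ "(x + y * B) / ?N"] bexI[of _ "- y / ?N"]) (auto simp: ops)
  next
    case (eng_add h1 h2)
    then obtain x y x' y' where "x \<in> \<rat>" "y \<in> \<rat>" "h1 = x + y * \<gamma>" "x' \<in> \<rat>" "y' \<in> \<rat>" "h2 = x' + y' * \<gamma>"
      by blast
    then show ?case
      by (intro bexI[of _ "x + x'"] bexI[of _ "y + y'"]) (auto simp: ring_of_type_algebra_def algebra_simps)
  next
    case (eng_mult h1 h2)
    then obtain x y x' y' where xy: "x \<in> \<rat>" "y \<in> \<rat>" "h1 = x + y * \<gamma>" "x' \<in> \<rat>" "y' \<in> \<rat>" "h2 = x' + y' * \<gamma>"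
      by blast
    have "h1 * h2 = x * x' + (x * y' + x' * y) * \<gamma> + y * y' * (\<gamma> * \<gamma>)"
      unfolding xy by (simp add: algebra_simps)
    also have "\<dots> = (x * x' + y * y' * C) + (x * y' + x' * y + y * y' * B) * \<gamma>"
      unfolding BC by (simp add: algebra_simps)
    finally show ?case
      using xy BC by (intro bexI[of _ "x * x' + y * y' * C"] bexI[of _ "x * y' + x' * y + y * y' * B"])
        (auto simp: ring_of_type_algebra_def)
  qed
qed

lemma rat_adjoin_inverse:
  assumes "z \<in> rat_adjoin \<gamma>" "z \<noteq> 0"
  shows "1 / z \<in> rat_adjoin \<gamma>"
proof -
  interpret R: field "ring_of_type_algebra :: real ring" by rule
  have "m_inv (ring_of_type_algebra :: real ring) z = 1 / z"
    using assms(2) by (intro R.comm_inv_char) (auto simp: ring_of_type_algebra_def)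
  with generate_field.m_inv[of z "ring_of_type_algebra :: real ring" "{\<gamma>}"] assms
  show ?thesis by (simp add: rat_adjoin_def ring_of_type_algebra_def)
qed

lemma rat_adjoin_common_denominator:
  assumes "quadratic_irrational \<gamma>" "z \<in> rat_adjoin \<gamma>"
  obtains r s t :: int where "t > 0" "z = (of_int r + of_int s * \<gamma>) / of_int t"
proof -
  obtain x y where "x \<in> \<rat>" "y \<in> \<rat>" and z: "z = x + y * \<gamma>"
    using rat_adjoin_cases[OF assms] by blast
  then obtain p q p' q' :: int where "q > 0" "x = p / q" "q' > 0" "y = p' / q'"
    by (metis Rats_cases')
  then show ?thesis
    by (intro that[of "q * q'" "p * q'" "p' * q"]) (auto simp: z field_simps)
qed

text \<open>Two steps of the recursion contract the distance of the tails by at least the factor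
  1/2. This transfers periodicity from the partial quotients to the complete quotients.\<close>

lemma cf_tails_unique:
  fixes b :: "nat \<Rightarrow> int" and g h :: "nat \<Rightarrow> real"
  assumes b: "\<And>i. b i \<ge> 1"
    and g: "\<And>i. 0 < g i" "\<And>i. g i < 1" "\<And>i. 1 / g i = of_int (b i) + g (Suc i)"
    and h: "\<And>i. 0 < h i" "\<And>i. h i < 1" "\<And>i. 1 / h i = of_int (b i) + h (Suc i)"
  shows "g i = h i"
proof -
  have step: "\<bar>g i - h i\<bar> = g i * h i * \<bar>g (Suc i) - h (Suc i)\<bar>" for i
  proof -
    have "g i - h i = g i * h i * (1 / h i - 1 / g i)"
      using g(1)[of i] h(1)[of i] by (simp add: right_diff_distrib)
    also have "1 / h i - 1 / g i = h (Suc i) - g (Suc i)" using g(3) h(3) by simp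
    finally show ?thesis using g(1)[of i] h(1)[of i] by (simp add: abs_mult)
  qed
  have half: "g i * g (Suc i) \<le> 1 / 2" for i
  proof -
    have "1 = g i * (of_int (b i) + g (Suc i))" using g(1)[of i] by (simp flip: g(3))
    moreover have "g i * 1 \<le> g i * of_int (b i)"
      using b[of i] g(1)[of i] by (intro mult_left_mono) auto
    moreover have "g i * g (Suc i) \<le> g i * 1"
      using g(1)[of i] g(2)[of "Suc i"] by (intro mult_left_mono) auto
    ultimately show ?thesis by (simp add: distrib_left)
  qed
  have bound: "\<bar>g i - h i\<bar> \<le> (1 / 2) ^ n" for n i
  proof (induction n arbitrary: i)
    case 0
    then show ?case using g(1,2)[of i] h(1,2)[of i] by simp
  next
    case (Suc n)
    have "\<bar>g i - h i\<bar> = (g i * g (Suc i)) * (h i * h (Suc i)) * \<bar>g (Suc (Suc i)) - h (Suc (Suc i))\<bar>"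
      using step[of i] step[of "Suc i"] by simp
    also have "\<dots> \<le> (1 / 2) * 1 * (1 / 2) ^ n"
      using half[of i] g(1) h(1) h(2)[of i] h(2)[of "Suc i"] Suc.IH[of "Suc (Suc i)"]
      by (intro mult_mono mult_le_one mult_nonneg_nonneg) (auto intro: less_imp_le)
    finally show ?case by simp
  qed
  show ?thesis
  proof (rule ccontr)
    assume "g i \<noteq> h i"
    then obtain n where "(1 / 2) ^ n < \<bar>g i - h i\<bar>"
      using real_arch_pow_inv[of "\<bar>g i - h i\<bar>" "1 / 2"] by auto
    with bound[of i n] show False by simp
  qed
qed

section \<open>Continued fractions of \<gamma> and of its inverse\<close>

lemma complete_quotient_irrational_gt_1:
  assumes "x > 1" "x \<notin> \<rat>"
  shows "complete_quotient x i > 1 \<and> complete_quotient x i \<notin> \<rat>"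
proof (induction i)
  case (Suc i)
  let ?f = "frac (complete_quotient x i)"
  have "complete_quotient x i = of_int \<lfloor>complete_quotient x i\<rfloor> + ?f" by (simp add: frac_def)
  with Suc have f: "?f \<notin> \<rat>" by (metis Rats_add Rats_of_int)
  then have "0 < ?f" "?f < 1"
    using frac_ge_0[of "complete_quotient x i"] frac_lt_1 Rats_0 by (metis less_eq_real_def)+
  moreover have "1 / ?f \<notin> \<rat>" using f by (metis Rats_divide Rats_1 div_by_1 divide_divide_eq_right mult_1)
  ultimately show ?case by simp
qed (use assms in simp)

lemma complete_quotient_inverse:
  assumes "0 < \<gamma>" "\<gamma> < 1"
  shows "complete_quotient \<gamma> (Suc i) = complete_quotient (1 / \<gamma>) i"
proof (induction i)
  case 0
  have "frac \<gamma> = \<gamma>" using assms by (simp add: frac_eq)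
  then show ?case by simp
qed simp

text \<open>Two shifts by one: the expansion of \<open>1 / \<gamma>\<close> drops the leading 0 of
  that of \<gamma>, and \<open>lin_rec\<close> starts at q_(-1).\<close>

lemma cf_denom_eq_lin_rec:
  assumes "0 < \<gamma>" "\<gamma> < 1"
  shows "cf_denom \<gamma> i = lin_rec (partial_quotient (1 / \<gamma>)) 0 1 (Suc i)"
proof -
  have "partial_quotient \<gamma> (Suc i) = partial_quotient (1 / \<gamma>) i" for i
    by (simp only: partial_quotient_def complete_quotient_inverse[OF assms])
  then show ?thesis
    by (induction i rule: induct_nat_012) (auto simp: eval_nat_numeral)
qed

lemma periodic_cf_inverse:
  fixes \<gamma> :: real and a :: "nat \<Rightarrow> int"
  assumes "0 < \<gamma>" "\<gamma> < 1" "\<gamma> \<notin> \<rat>" "P \<ge> 1"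
    and per: "\<forall>i. partial_quotient (1 / \<gamma>) i = a (i mod P + 1)"
  shows "periodic_cf (partial_quotient (1 / \<gamma>)) (\<lambda>i. 1 / complete_quotient (1 / \<gamma>) i) P"
proof -
  let ?b = "partial_quotient (1 / \<gamma>)" and ?g = "\<lambda>i. 1 / complete_quotient (1 / \<gamma>) i"
  have "1 / \<gamma> \<notin> \<rat>"
    using assms(3) by (metis Rats_divide Rats_1 div_by_1 divide_divide_eq_right mult_1)
  then have cq: "complete_quotient (1 / \<gamma>) i > 1" for i
    using complete_quotient_irrational_gt_1[of "1 / \<gamma>" i] assms(1,2) by simp
  have b: "?b i \<ge> 1" for i
    unfolding partial_quotient_def using cq[of i] by (simp add: le_floor_iff)
  have g: "0 < ?g i" "?g i < 1" for i using cq[of i] by auto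
  have step: "1 / ?g i = of_int (?b i) + ?g (Suc i)" for i
    by (simp add: partial_quotient_def frac_def)
  have per_b: "?b (i + P) = ?b i" for i using per by simp
  have "?g (i + P) = ?g i" for i
  \<comment> \<open>The tails shifted by \<open>P\<close> obey the recursion with the same partial
    quotients.\<close>
  proof (rule cf_tails_unique[where b = ?b and g = "\<lambda>i. ?g (i + P)" and h = ?g])
    show "1 / ?g (i + P) = of_int (?b i) + ?g (Suc i + P)" for i
      using step[of "i + P"] unfolding per_b by simp
  qed (use b g step in auto)
  with b g step per_b assms(4) show ?thesis
    unfolding periodic_cf_def by auto
qed

section \<open>Assembling the automaton from the digit conditions\<close>

theorem theorem22:
  fixes \<gamma> \<alpha> :: real and P :: nat and a :: "nat \<Rightarrow> int"
  assumes "0 < \<gamma>" and "\<gamma> < 1"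
    and "quadratic_irrational \<gamma>"
    and "P \<ge> 1"
    and "\<forall>i. partial_quotient (1 / \<gamma>) i = a (i mod P + 1)"
    and "\<alpha> \<in> rat_adjoin \<gamma>" and "\<alpha> \<ge> 0"
  shows "ostrowski_automatic \<gamma> (sums_complement \<alpha>)"
proof -
  let ?b = "partial_quotient (1 / \<gamma>)" and ?g = "\<lambda>i. 1 / complete_quotient (1 / \<gamma>) i"
  have "\<gamma> \<notin> \<rat>" using assms(3) by (simp add: quadratic_irrational_def)
  with assms interpret periodic_cf ?b ?g P
    by (intro periodic_cf_inverse) auto
  have g0: "?g 0 = \<gamma>" by simp
  \<comment> \<open>By periodicity, the maximum over one period bounds all partial quotients and
    hence all digits.\<close>
  define A where "A = nat (Max ((\<lambda>c. a (c + 1)) ` {..<P}))"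
  have "?b i \<le> int A" for i
  proof -
    have "a (i mod P + 1) \<le> Max ((\<lambda>c. a (c + 1)) ` {..<P})"
      using P_pos by (intro Max_ge) auto
    then show ?thesis using assms(5) by (simp add: A_def)
  qed
  moreover have "int (rev w ! i) \<le> ?b i" if "ostrowski_rep \<gamma> w n" "i < length w" for w n i
  proof -
    have "partial_quotient \<gamma> (i + 1) = ?b i"
      using complete_quotient_inverse[OF assms(1,2), of i] by (simp add: partial_quotient_def)
    moreover have "int (rev w ! i) \<le> partial_quotient \<gamma> (i + 1)"
      using that by (cases "i = 0") (auto simp: ostrowski_rep_def Let_def)
    ultimately show ?thesis by simp
  qed
  ultimately have rev_le: "rev w ! i \<le> A" if "ostrowski_rep \<gamma> w n" "i < length w" for w n i
    using that by (metis of_nat_le_iff order_trans)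
  have digits: "w \<in> lists {..A}" if rep: "ostrowski_rep \<gamma> w n" for w n
  proof (rule in_listsI, rule ballI)
    fix d assume "d \<in> set w"
    then obtain i where "i < length w" "d = rev w ! i"
      by (metis in_set_conv_nth length_rev set_rev)
    with rev_le[OF rep] show "d \<in> {..A}" by simp
  qed
  have val: "digit_val ?b 0 1 w = int n" if "ostrowski_rep \<gamma> w n" for w n
    using that by (simp add: digit_val_eq_sum ostrowski_rep_def Let_def cf_denom_eq_lin_rec[OF assms(1,2)])
  have "\<exists>F. finite_index {..A} F \<and>
    (\<forall>w\<in>lists {..A}. \<forall>n. digit_val ?b 0 1 w = int n \<longrightarrow> F w = (n \<in> sums_complement \<alpha>))"
  proof (cases "\<alpha> = 0")
    case True
    \<comment> \<open>The criterion through \<open>1 / \<alpha>\<close> requires \<alpha> > 0; here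
      it only has to be decided whether the word represents a nonzero number.\<close>
    have "finite_index {..A} (\<lambda>w. \<not> set w \<subseteq> {0})"
      by (rule finite_indexI[where \<sigma> = "\<lambda>v. set v \<subseteq> {0}"]) auto
    moreover have "(\<not> set w \<subseteq> {0}) = (n \<in> sums_complement \<alpha>)" if "digit_val ?b 0 1 w = int n" for w n
      using that True by (auto simp: sums_complement_def simp flip: digit_val_eq_0_iff)
    ultimately show ?thesis
      by (intro exI[of _ "\<lambda>w. \<not> set w \<subseteq> {0}"] conjI ballI allI impI)
  next
    case False
    then obtain r s t :: int where "t > 0" "1 / \<alpha> = (of_int r + of_int s * ?g 0) / of_int t"
      using rat_adjoin_common_denominator[OF assms(3) rat_adjoin_inverse[OF assms(6)]] g0 by metis
    then have "finite_index {..A} (\<lambda>w. \<not> (w \<in> lists {..A} \<and>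
        (\<exists>k::int. \<bar>of_int (digit_val ?b 0 1 w) * (1 / \<alpha>) - of_int k\<bar> < 1 / \<alpha>)))"
      by (intro finite_index_compose2[where H = "\<lambda>x _. \<not> x", OF finite_index_near_int finite_index_const])
    moreover have "\<alpha> > 0" using False assms(7) by simp
    ultimately show ?thesis
      by (intro exI conjI ballI allI impI) (assumption, simp add: sums_complement_iff)
  qed
  then obtain F where F: "finite_index {..A} F"
    "\<And>w n. w \<in> lists {..A} \<Longrightarrow> digit_val ?b 0 1 w = int n \<Longrightarrow> F w = (n \<in> sums_complement \<alpha>)"
    by blast
  obtain M :: "(nat, nat) dfa" where "wf_dfa M" "dfa_alphabet M = {..A}"
    "\<And>w. w \<in> lists {..A} \<Longrightarrow> dfa_accepts M w \<longleftrightarrow> F w"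
    using finite_index_dfa[OF _ F(1)] by blast
  then show ?thesis
    unfolding ostrowski_automatic_def using digits val F(2) by (intro exI[of _ M]) simp
qed

end
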